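(* For all $u,t\in\mathbb{C}$ with $|u|<1$ and $|t|=1$, and all $(z,w)\in\mathbb{C}^2$, $$\sum_{m=0}^{+\infty}\sum_{n=0}^{+\infty}\frac{u^mt^n}{m!\,n!}H_{m,n,n,m}(z,w)=\frac{e^{t(\overline{z}^2+\overline{w}^2)}}{1-ut}\exp\left(-\frac{ut}{1-ut}\left|z-t\overline{z}+i(w-t\overline{w})\right|^2\right).$$ In particular, for every $u\in\mathbb{C}$ with $|u|<1$, $$\sum_{m=0}^{+\infty}\sum_{n=0}^{+\infty}\frac{u^m}{m!\,n!}H_{m,n,n,m}(z,w)=\frac{e^{\overline{z}^2+\overline{w}^2}}{1-u}\exp\left(-\frac{4u}{1-u}\left((\mathrm{Im}\,z)^2+(\mathrm{Im}\,w)^2\right)\right).$$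
   Context: For integers $m,n\ge 0$ and $\zeta\in\mathbb{C}$, $H_{m,n}(\zeta,\overline{\zeta})=(-1)^{m+n}e^{|\zeta|^2}\frac{\partial^{m+n}}{\partial\overline{\zeta}^{m}\partial\zeta^{n}}\left(e^{-|\zeta|^2}\right)$ (Wirtinger derivatives), and for $(z,w)\in\mathbb{C}^2$, $H_{m,n,m',n'}(z,w)=H_{m,n}(z+iw,\overline{z}-i\overline{w})\,H_{m',n'}(\overline{z}+i\overline{w},z-iw)$. *)

theory Defs
  imports "HOL-Analysis.Analysis"
begin

definition partial_x :: "(complex \<Rightarrow> complex) \<Rightarrow> complex \<Rightarrow> complex" where
  "partial_x f \<zeta> = vector_derivative (\<lambda>s::real. f (\<zeta> + of_real s)) (at 0)"

definition partial_y :: "(complex \<Rightarrow> complex) \<Rightarrow> complex \<Rightarrow> complex" where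
  "partial_y f \<zeta> = vector_derivative (\<lambda>s::real. f (\<zeta> + \<i> * of_real s)) (at 0)"

definition wirtinger :: "(complex \<Rightarrow> complex) \<Rightarrow> complex \<Rightarrow> complex" where
  "wirtinger f \<zeta> = (partial_x f \<zeta> - \<i> * partial_y f \<zeta>) / 2"

definition wirtinger_cnj :: "(complex \<Rightarrow> complex) \<Rightarrow> complex \<Rightarrow> complex" where
  "wirtinger_cnj f \<zeta> = (partial_x f \<zeta> + \<i> * partial_y f \<zeta>) / 2"

text \<open>In the notation H_{m,n}(\<zeta>, cnj \<zeta>) the second argument is always the conjugate of the
  first, so only \<zeta> is a parameter here.\<close>

definition ito_hermite :: "nat \<Rightarrow> nat \<Rightarrow> complex \<Rightarrow> complex" where
  "ito_hermite m n \<zeta> =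
     (-1) ^ (m + n) * exp (of_real ((cmod \<zeta>)\<^sup>2)) *
     (wirtinger_cnj ^^ m) ((wirtinger ^^ n) (\<lambda>\<xi>. exp (- of_real ((cmod \<xi>)\<^sup>2)))) \<zeta>"

text \<open>The factors are H_{m,n}(z + iw, cnj z - i cnj w) and H_{m',n'}(cnj z + i cnj w, z - iw);
  in each of them the omitted second argument is indeed the conjugate of the first.\<close>

definition ito_hermite2 ::
  "nat \<Rightarrow> nat \<Rightarrow> nat \<Rightarrow> nat \<Rightarrow> complex \<Rightarrow> complex \<Rightarrow> complex" where
  "ito_hermite2 m n m' n' z w =
     ito_hermite m n (z + \<i> * w) * ito_hermite m' n' (cnj z + \<i> * cnj w)"

end

(* The polynomials H_{m,n} satisfy two first-order recurrences, one in each index. Summing them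
   against t^n / n! shows that, with a = z + i w and b = cnj z + i cnj w, the inner sum equals
   exp (t b cnj a) times (cnj b - t cnj a + t d/dX)^m X^m at X = a - t b. When |t| = 1 we have
   cnj b - t cnj a = - t cnj (a - t b), so this is m! t^m L_m(|a - t b|^2) with L_m the Laguerre
   polynomial, and the outer sum is the Laguerre generating function at u t. *)

theory Submission
  imports Defs
begin

section \<open>The Ito--Hermite polynomials\<close>

text \<open>The conjugate is decoupled into an independent variable \<open>y\<close>, so that
  \<open>H_{m,n}\<close> becomes a polynomial in two variables. At \<open>n = 0\<close> the
  truncated index \<open>n - 1\<close> is harmless because its coefficient vanishes.\<close>

fun ito_poly :: "nat \<Rightarrow> nat \<Rightarrow> complex \<Rightarrow> complex \<Rightarrow> complex" where
  "ito_poly 0 n x y = y ^ n"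
| "ito_poly (Suc m) n x y = x * ito_poly m n x y - of_nat n * ito_poly m (n - 1) x y"

lemma ito_poly_0_right: "ito_poly m 0 x y = x ^ m"
  by (induction m) auto

text \<open>The defining recursion moves only the first index. This is its mirror image, which holds
  because the polynomials are symmetric under exchanging both the indices and the variables.\<close>

lemma ito_poly_Suc_right:
  "ito_poly m (Suc n) x y = y * ito_poly m n x y - of_nat m * ito_poly (m - 1) n x y"
proof (induction m arbitrary: n)
  case 0
  then show ?case by simp
next
  case (Suc m)
  \<comment> \<open>The recursion for index \<open>m\<close>, multiplied by \<open>m\<close> so that
    it also holds at \<open>m = 0\<close>, where both sides vanish.\<close>
  have x: "of_nat m * ito_poly m n x y =
      of_nat m * (x * ito_poly (m - 1) n x y - of_nat n * ito_poly (m - 1) (n - 1) x y)"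
    by (cases m) auto
  show ?case
  proof (cases n)
    case 0
    then show ?thesis using x by (simp add: Suc algebra_simps)
  next
    case (Suc k)
    then show ?thesis using x by (simp add: Suc.IH algebra_simps)
  qed
qed

text \<open>Each partial derivative lowers one index, as for monomials. Writing the real derivative
  as a combination of \<open>h\<close> and \<open>cnj h\<close> records both Wirtinger derivatives
  at once.\<close>

lemma has_derivative_ito_poly:
  "((\<lambda>\<zeta>. ito_poly m n \<zeta> (cnj \<zeta>)) has_derivative
     (\<lambda>h. of_nat m * ito_poly (m - 1) n \<zeta> (cnj \<zeta>) * h +
          of_nat n * ito_poly m (n - 1) \<zeta> (cnj \<zeta>) * cnj h)) (at \<zeta>)"
proof (induction m arbitrary: n)
  case 0
  have "((\<lambda>\<zeta>. cnj \<zeta> ^ n) has_derivative (\<lambda>h. of_nat n * cnj h * cnj \<zeta> ^ (n - 1))) (at \<zeta>)"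
    by (rule has_derivative_power
        [OF bounded_linear.has_derivative[OF bounded_linear_cnj has_derivative_ident]])
  then show ?case by (simp add: mult_ac)
next
  case (Suc m)
  have x: "of_nat m * ito_poly m n \<zeta> (cnj \<zeta>) =
      of_nat m * (\<zeta> * ito_poly (m - 1) n \<zeta> (cnj \<zeta>)
        - of_nat n * ito_poly (m - 1) (n - 1) \<zeta> (cnj \<zeta>))"
    by (cases m) auto
  have d: "((\<lambda>\<zeta>. \<zeta> * ito_poly m n \<zeta> (cnj \<zeta>) - of_nat n * ito_poly m (n - 1) \<zeta> (cnj \<zeta>))
      has_derivative
      (\<lambda>h. \<zeta> * (of_nat m * ito_poly (m - 1) n \<zeta> (cnj \<zeta>) * h +
              of_nat n * ito_poly m (n - 1) \<zeta> (cnj \<zeta>) * cnj h) + h * ito_poly m n \<zeta> (cnj \<zeta>)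
        - of_nat n * (of_nat m * ito_poly (m - 1) (n - 1) \<zeta> (cnj \<zeta>) * h +
              of_nat (n - 1) * ito_poly m (n - 1 - 1) \<zeta> (cnj \<zeta>) * cnj h))) (at \<zeta>)"
    by (intro has_derivative_diff has_derivative_mult has_derivative_ident Suc
        has_derivative_mult_right)
  have "\<zeta> * (of_nat m * ito_poly (m - 1) n \<zeta> (cnj \<zeta>) * h +
              of_nat n * ito_poly m (n - 1) \<zeta> (cnj \<zeta>) * cnj h) + h * ito_poly m n \<zeta> (cnj \<zeta>)
        - of_nat n * (of_nat m * ito_poly (m - 1) (n - 1) \<zeta> (cnj \<zeta>) * h +
              of_nat (n - 1) * ito_poly m (n - 1 - 1) \<zeta> (cnj \<zeta>) * cnj h)
      = of_nat (Suc m) * ito_poly m n \<zeta> (cnj \<zeta>) * h +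
          of_nat n * ito_poly (Suc m) (n - 1) \<zeta> (cnj \<zeta>) * cnj h" (is "?l h = ?r h") for h
  proof -
    have "?l h = (of_nat m * (\<zeta> * ito_poly (m - 1) n \<zeta> (cnj \<zeta>)
          - of_nat n * ito_poly (m - 1) (n - 1) \<zeta> (cnj \<zeta>))) * h + h * ito_poly m n \<zeta> (cnj \<zeta>)
          + of_nat n * ito_poly (Suc m) (n - 1) \<zeta> (cnj \<zeta>) * cnj h"
      by (simp add: algebra_simps)
    also have "\<dots> = ?r h"
      unfolding x[symmetric] by (simp add: algebra_simps)
    finally show ?thesis .
  qed
  with d show ?case by simp
qed

section \<open>Wirtinger derivatives of a polynomial times the Gaussian\<close>

lemma vector_derivative_along:
  assumes "(f has_derivative (\<lambda>h. A * h + B * cnj h)) (at \<zeta>)"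
  shows "vector_derivative (\<lambda>s::real. f (\<zeta> + v * of_real s)) (at 0) = A * v + B * cnj v"
proof (rule vector_derivative_at)
  have g: "((\<lambda>s::real. \<zeta> + v * of_real s) has_derivative (\<lambda>s. v * of_real s)) (at 0)"
    by (auto intro!: derivative_eq_intros)
  have f: "(f has_derivative (\<lambda>h. A * h + B * cnj h)) (at (\<zeta> + v * of_real (0::real)))"
    using assms by simp
  show "((\<lambda>s::real. f (\<zeta> + v * of_real s)) has_vector_derivative A * v + B * cnj v) (at 0)"
    unfolding has_vector_derivative_def
    using has_derivative_compose[OF g f] by (simp add: scaleR_conv_of_real algebra_simps)
qed

text \<open>The directions 1 and \<open>\<i>\<close> give \<open>A + B\<close> and
  \<open>\<i> * (A - B)\<close>; the two Wirtinger combinations isolate \<open>A\<close> and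
  \<open>B\<close>.\<close>

lemma
  assumes "(f has_derivative (\<lambda>h. A * h + B * cnj h)) (at \<zeta>)"
  shows wirtinger_eq: "wirtinger f \<zeta> = A" and wirtinger_cnj_eq: "wirtinger_cnj f \<zeta> = B"
proof -
  have "partial_x f \<zeta> = A + B" and "partial_y f \<zeta> = A * \<i> - B * \<i>"
    using vector_derivative_along[OF assms, of 1] vector_derivative_along[OF assms, of \<i>]
    by (simp_all add: partial_x_def partial_y_def)
  then show "wirtinger f \<zeta> = A" and "wirtinger_cnj f \<zeta> = B"
    by (simp_all only: wirtinger_def wirtinger_cnj_def) (simp_all add: algebra_simps)
qed

text \<open>The product rule gives the \<open>cnj h\<close> coefficient
  \<open>n H_{m,n-1} - \<zeta> H_{m,n}\<close>, which is \<open>- H_{m+1,n}\<close> by the defining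
  recursion. The constant \<open>c\<close> carries the signs accumulated by repeated
  differentiation.\<close>

lemma has_derivative_ito_poly_gaussian:
  "((\<lambda>\<xi>. c * ito_poly m n \<xi> (cnj \<xi>) * exp (- of_real ((cmod \<xi>)\<^sup>2))) has_derivative
     (\<lambda>h. c * (of_nat m * ito_poly (m - 1) n \<zeta> (cnj \<zeta>) - cnj \<zeta> * ito_poly m n \<zeta> (cnj \<zeta>))
            * exp (- of_real ((cmod \<zeta>)\<^sup>2)) * h +
          (- c * ito_poly (Suc m) n \<zeta> (cnj \<zeta>)) * exp (- of_real ((cmod \<zeta>)\<^sup>2)) * cnj h)) (at \<zeta>)"
proof -
  have c: "(cnj has_derivative cnj) (at \<zeta>)"
    by (rule bounded_linear.has_derivative[OF bounded_linear_cnj has_derivative_ident])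
  have e: "((\<lambda>\<xi>. exp (- (\<xi> * cnj \<xi>))) has_derivative
      (\<lambda>h. - (\<zeta> * cnj h + h * cnj \<zeta>) * exp (- (\<zeta> * cnj \<zeta>)))) (at \<zeta>)"
    using has_derivative_compose[OF has_derivative_minus[OF has_derivative_mult[OF has_derivative_ident c]]
        DERIV_exp[unfolded has_field_derivative_def]]
    by (simp add: mult.commute)
  show ?thesis
    unfolding complex_norm_square
    by (rule has_derivative_eq_rhs
        [OF has_derivative_mult[OF has_derivative_mult_right[OF has_derivative_ito_poly] e]])
       (auto simp: fun_eq_iff algebra_simps)
qed

lemma wirtinger_power_gaussian:
  "(wirtinger ^^ n) (\<lambda>\<xi>. exp (- of_real ((cmod \<xi>)\<^sup>2))) =
     (\<lambda>\<xi>. (-1) ^ n * ito_poly 0 n \<xi> (cnj \<xi>) * exp (- of_real ((cmod \<xi>)\<^sup>2)))"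
proof (induction n)
  case (Suc n)
  show ?case
    unfolding funpow.simps o_def Suc
    by (rule ext, subst wirtinger_eq[OF has_derivative_ito_poly_gaussian]) simp
qed simp

lemma wirtinger_cnj_power_gaussian:
  "(wirtinger_cnj ^^ m) (\<lambda>\<xi>. c * ito_poly 0 n \<xi> (cnj \<xi>) * exp (- of_real ((cmod \<xi>)\<^sup>2))) =
     (\<lambda>\<xi>. (-1) ^ m * c * ito_poly m n \<xi> (cnj \<xi>) * exp (- of_real ((cmod \<xi>)\<^sup>2)))"
proof (induction m)
  case (Suc m)
  show ?case
    unfolding funpow.simps o_def Suc
    by (rule ext, subst wirtinger_cnj_eq[OF has_derivative_ito_poly_gaussian]) simp
qed simp

text \<open>Each derivative contributes a factor -1 and raises one index; the prefactor then cancels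
  all signs and the Gaussian.\<close>

lemma ito_hermite_eq: "ito_hermite m n \<zeta> = ito_poly m n \<zeta> (cnj \<zeta>)"
proof -
  have "ito_hermite m n \<zeta> = ((-1) ^ m * (-1) ^ m) * ((-1) ^ n * (-1) ^ n) *
      (exp (of_real ((cmod \<zeta>)\<^sup>2)) * exp (- of_real ((cmod \<zeta>)\<^sup>2))) * ito_poly m n \<zeta> (cnj \<zeta>)"
    unfolding ito_hermite_def wirtinger_power_gaussian wirtinger_cnj_power_gaussian
    by (simp only: power_add mult_ac)
  also have "\<dots> = ito_poly m n \<zeta> (cnj \<zeta>)"
    by (simp flip: power_mult_distrib exp_add)
  finally show ?thesis .
qed

section \<open>The inner sum\<close>

text \<open>For \<open>p = 0\<close> this is the exponential series. Raising \<open>p\<close>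
  multiplies the sum by \<open>a - y\<close>: the term \<open>n H_{p,n-1}\<close> of the recursion,
  after an index shift, contributes \<open>y\<close> times the previous sum.\<close>

lemma ito_poly_sums:
  "(\<lambda>n. y ^ n / fact n * ito_poly p n a a') sums ((a - y) ^ p * exp (y * a'))"
proof (induction p)
  case 0
  have "(\<lambda>n. (y * a') ^ n /\<^sub>R fact n) sums exp (y * a')"
    by (rule exp_converges)
  then show ?case
    by (simp add: scaleR_conv_of_real field_simps)
next
  case (Suc p)
  have "(\<lambda>n. y ^ Suc n / fact (Suc n) * (of_nat (Suc n) * ito_poly p (Suc n - 1) a a'))
      sums (y * ((a - y) ^ p * exp (y * a')))"
    using sums_mult[OF Suc, of y] by (simp add: field_simps del: of_nat_Suc)
  \<comment> \<open>The factor \<open>n\<close> kills the term at 0, so shifting the index leaves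
    the sum unchanged.\<close>
  then have "(\<lambda>n. y ^ n / fact n * (of_nat n * ito_poly p (n - 1) a a'))
      sums (y * ((a - y) ^ p * exp (y * a')))"
    by (subst (asm) sums_Suc_iff) simp
  from sums_diff[OF sums_mult[OF Suc, of a] this] show ?case
    by (simp add: algebra_simps)
qed

text \<open>The polynomial is \<open>(\<beta> + t d/d\<alpha>)\<^sup>q \<alpha>\<^sup>p\<close>.\<close>

fun shifted_deriv_poly :: "complex \<Rightarrow> complex \<Rightarrow> complex \<Rightarrow> nat \<Rightarrow> nat \<Rightarrow> complex" where
  "shifted_deriv_poly t \<alpha> \<beta> p 0 = \<alpha> ^ p"
| "shifted_deriv_poly t \<alpha> \<beta> p (Suc q) =
     \<beta> * shifted_deriv_poly t \<alpha> \<beta> p q + t * of_nat p * shifted_deriv_poly t \<alpha> \<beta> (p - 1) q"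

text \<open>Raising \<open>q\<close> produces \<open>b' H_{n,q} - n H_{n-1,q}\<close> in the second
  factor. After an index shift the last term is paired with
  \<open>H_{p,n+1} = a' H_{p,n} - p H_{p-1,n}\<close>, so the sum obeys the recursion of
  \<open>shifted_deriv_poly\<close>. Since \<open>p - 1\<close> occurs, the induction leaves
  \<open>p\<close> arbitrary.\<close>

lemma ito_poly_mult_sums:
  "(\<lambda>n. t ^ n / fact n * (ito_poly p n a a' * ito_poly n q b b')) sums
     (exp (t * a' * b) * shifted_deriv_poly t (a - t * b) (b' - t * a') p q)"
proof (induction q arbitrary: p)
  case 0
  show ?case
    using ito_poly_sums[of "t * b" p a a']
    by (simp add: ito_poly_0_right power_mult_distrib mult_ac)
next
  case (Suc q)
  let ?P = "\<lambda>p q. exp (t * a' * b) * shifted_deriv_poly t (a - t * b) (b' - t * a') p q"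
  have "(\<lambda>n. t ^ n / fact n * (ito_poly p (Suc n) a a' * ito_poly n q b b'))
      sums (a' * ?P p q - of_nat p * ?P (p - 1) q)"
    using sums_diff[OF sums_mult[OF Suc, of a' p] sums_mult[OF Suc, of "of_nat p" "p - 1"]]
    by (simp add: ito_poly_Suc_right algebra_simps)
  from sums_mult[OF this, of t]
  have "(\<lambda>n. t ^ Suc n / fact (Suc n) *
          (ito_poly p (Suc n) a a' * (of_nat (Suc n) * ito_poly (Suc n - 1) q b b')))
      sums (t * (a' * ?P p q - of_nat p * ?P (p - 1) q))"
    by (simp add: field_simps del: of_nat_Suc)
  then have "(\<lambda>n. t ^ n / fact n * (ito_poly p n a a' * (of_nat n * ito_poly (n - 1) q b b')))
      sums (t * (a' * ?P p q - of_nat p * ?P (p - 1) q))"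
    by (subst (asm) sums_Suc_iff) simp
  from sums_diff[OF sums_mult[OF Suc, of b' p] this] show ?case
    by (simp add: ito_poly_Suc_right algebra_simps)
qed

text \<open>Multiplication by the constant \<beta> commutes with \<open>t d/d\<alpha>\<close>, so
  the operator power expands binomially. The factor \<open>(p choose j) * fact j\<close> is the
  falling factorial from differentiating \<open>\<alpha> ^ p\<close> j times; it vanishes for
  \<open>j > p\<close>.\<close>

lemma shifted_deriv_poly_eq:
  "shifted_deriv_poly t \<alpha> \<beta> p q =
     (\<Sum>j\<le>q. of_nat (q choose j) * (of_nat (p choose j) * fact j) * t ^ j * \<alpha> ^ (p - j) * \<beta> ^ (q - j))"
proof (induction q arbitrary: p)
  case 0
  show ?case by simp
next
  case (Suc q)
  \<comment> \<open>\<open>F p j\<close> is \<open>(t d/d\<alpha>)^j\<close> applied to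
    \<open>\<alpha> ^ p\<close>.\<close>
  define F where "F p j = of_nat (p choose j) * fact j * t ^ j * \<alpha> ^ (p - j)" for p j
  have IH: "shifted_deriv_poly t \<alpha> \<beta> p q = (\<Sum>j\<le>q. of_nat (q choose j) * F p j * \<beta> ^ (q - j))" for p
    by (simp add: Suc F_def mult_ac)
  have F_Suc: "t * of_nat p * F (p - 1) j = F p (Suc j)" for j
  proof (cases p)
    case (Suc k)
    have "of_nat (Suc k) * of_nat (k choose j) = (of_nat (Suc j) * of_nat (Suc k choose Suc j) :: complex)"
      by (metis Suc_times_binomial of_nat_mult)
    then show ?thesis
      using Suc by (simp add: F_def field_simps del: of_nat_Suc binomial_Suc_Suc)
  qed (simp add: F_def)
  have "(\<Sum>j\<le>Suc q. of_nat (Suc q choose j) * F p j * \<beta> ^ (Suc q - j)) =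
      F p 0 * \<beta> ^ Suc q + (\<Sum>j\<le>q. of_nat (Suc q choose Suc j) * F p (Suc j) * \<beta> ^ (q - j))"
    by (subst sum.atMost_Suc_shift) simp
  \<comment> \<open>Pascal's rule splits the binomial coefficient: one part is the \<beta> term of
    the recursion (its top summand is zero), the other the derivative term.\<close>
  also have "\<dots> = (F p 0 * \<beta> ^ Suc q + (\<Sum>j\<le>q. of_nat (q choose Suc j) * F p (Suc j) * \<beta> ^ (q - j)))
      + (\<Sum>j\<le>q. of_nat (q choose j) * F p (Suc j) * \<beta> ^ (q - j))"
    by (simp add: sum.distrib algebra_simps)
  also have "F p 0 * \<beta> ^ Suc q + (\<Sum>j\<le>q. of_nat (q choose Suc j) * F p (Suc j) * \<beta> ^ (q - j))
      = (\<Sum>j\<le>Suc q. of_nat (q choose j) * F p j * \<beta> ^ (Suc q - j))"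
    by (subst sum.atMost_Suc_shift) simp
  also have "\<dots> = \<beta> * shifted_deriv_poly t \<alpha> \<beta> p q"
    by (simp add: IH sum_distrib_left Suc_diff_le mult_ac)
  also have "(\<Sum>j\<le>q. of_nat (q choose j) * F p (Suc j) * \<beta> ^ (q - j)) =
      t * of_nat p * shifted_deriv_poly t \<alpha> \<beta> (p - 1) q"
    unfolding IH sum_distrib_left F_Suc[symmetric] by (simp add: mult_ac)
  finally show ?case
    by (simp add: F_def mult_ac)
qed

section \<open>Laguerre polynomials\<close>

definition laguerre :: "nat \<Rightarrow> complex \<Rightarrow> complex" where
  "laguerre m x = (\<Sum>k\<le>m. of_nat (m choose k) * (- x) ^ k / fact k)"

text \<open>When both indices equal \<open>m\<close>, the powers of \<alpha> and \<beta> have the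
  same exponent \<open>m - j\<close> and combine into a power of \<open>- t * x\<close>. Every
  summand then contains \<open>t ^ m\<close>, and reversing the order of summation gives the
  Laguerre polynomial.\<close>

lemma shifted_deriv_poly_diagonal:
  assumes "\<alpha> * \<beta> = - t * x"
  shows "shifted_deriv_poly t \<alpha> \<beta> m m = fact m * t ^ m * laguerre m x"
proof -
  have "shifted_deriv_poly t \<alpha> \<beta> m m =
      (\<Sum>j\<le>m. of_nat (m choose j) * (of_nat (m choose j) * fact j) * t ^ j * (\<alpha> * \<beta>) ^ (m - j))"
    by (simp add: shifted_deriv_poly_eq power_mult_distrib mult_ac)
  also have "\<dots> = (\<Sum>j\<le>m. fact m * t ^ m * (of_nat (m choose (m - j)) * (- x) ^ (m - j) / fact (m - j)))"
  proof (rule sum.cong[OF refl])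
    fix j assume "j \<in> {..m}"
    then have j: "j \<le> m" by simp
    have "of_nat (m choose j) * fact j = (fact m / fact (m - j) :: complex)"
      using binomial_fact[OF j, where ?'a = complex] by simp
    moreover have "t ^ j * (\<alpha> * \<beta>) ^ (m - j) = t ^ m * (- x) ^ (m - j)"
      using j by (simp add: assms power_mult_distrib power_minus[of "t * x"] power_minus[of x] flip: power_add)
    moreover have "m choose (m - j) = m choose j"
      using binomial_symmetric[OF j] by simp
    ultimately show "of_nat (m choose j) * (of_nat (m choose j) * fact j) * t ^ j * (\<alpha> * \<beta>) ^ (m - j)
        = fact m * t ^ m * (of_nat (m choose (m - j)) * (- x) ^ (m - j) / fact (m - j))"
      by (simp add: mult.assoc)
  qed
  also have "\<dots> = fact m * t ^ m * laguerre m x"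
    unfolding laguerre_def sum_distrib_left
    by (rule sum.nat_diff_reindex[of "\<lambda>k. _ k" "Suc m", unfolded lessThan_Suc_atMost, simplified])
  finally show ?thesis .
qed

section \<open>Negative binomial series\<close>

lemma sum_choose_power:
  fixes r :: "'a :: comm_semiring_1"
  shows "(\<Sum>i\<le>m. (of_nat (i choose k) * r ^ i) * r ^ (m - i)) = of_nat (Suc m choose Suc k) * r ^ m"
proof -
  have "(\<Sum>i\<le>m. (of_nat (i choose k) * r ^ i) * r ^ (m - i)) = (\<Sum>i\<le>m. of_nat (i choose k) * r ^ m)"
    by (rule sum.cong) (simp_all add: mult.assoc flip: power_add)
  also have "\<dots> = of_nat (\<Sum>i\<le>m. i choose k) * r ^ m"
    by (simp add: sum_distrib_right)
  also have "(\<Sum>i\<le>m. i choose k) = Suc m choose Suc k"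
    using sum_choose_upper[of k m] by (simp add: atLeast0AtMost)
  finally show ?thesis .
qed

text \<open>Applied to \<open>norm r\<close>, this supplies the absolute convergence that the Cauchy
  product in the next lemma requires.\<close>

lemma choose_power_summable:
  fixes r :: real
  assumes "0 \<le> r" "r < 1"
  shows "summable (\<lambda>m. of_nat (m choose k) * r ^ m)"
proof (induction k)
  case 0
  show ?case using assms by simp
next
  case (Suc k)
  have "summable (\<lambda>m. \<Sum>i\<le>m. (of_nat (i choose k) * r ^ i) * r ^ (m - i))"
    by (rule summable_Cauchy_product) (use Suc assms in auto)
  then have "summable (\<lambda>m. r * (of_nat (Suc m choose Suc k) * r ^ m))"
    unfolding sum_choose_power by (rule summable_mult)
  then have "summable (\<lambda>m. of_nat (Suc m choose Suc k) * r ^ Suc m)"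
    by (simp only: power_Suc mult_ac)
  then show ?case
    by (subst (asm) summable_Suc_iff)
qed

text \<open>By the hockey-stick identity, the Cauchy product with the geometric series raises
  \<open>k\<close> by one, up to a factor \<open>r\<close> that comes from the index shift.\<close>

lemma choose_power_sums:
  fixes r :: "'a :: {real_normed_field, banach}"
  assumes "norm r < 1"
  shows "(\<lambda>m. of_nat (m choose k) * r ^ m) sums (r ^ k / (1 - r) ^ Suc k)"
proof (induction k)
  case 0
  show ?case using geometric_sums[OF assms] by simp
next
  case (Suc k)
  have "(\<lambda>m. \<Sum>i\<le>m. (of_nat (i choose k) * r ^ i) * r ^ (m - i)) sums
      ((\<Sum>m. of_nat (m choose k) * r ^ m) * (\<Sum>m. r ^ m))"
    by (rule Cauchy_product_sums)
       (use assms choose_power_summable[of "norm r" k] in \<open>auto simp: norm_mult norm_power\<close>)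
  then have "(\<lambda>m. of_nat (Suc m choose Suc k) * r ^ m) sums
      (r ^ k / (1 - r) ^ Suc k * (1 / (1 - r)))"
    unfolding sum_choose_power
    using sums_unique[OF Suc] sums_unique[OF geometric_sums[OF assms]] by simp
  from sums_mult[OF this, of r]
  have "(\<lambda>m. of_nat (Suc m choose Suc k) * r ^ Suc m) sums (r ^ Suc k / (1 - r) ^ Suc (Suc k))"
    by (simp add: mult_ac del: binomial_Suc_Suc)
  then show ?case
    by (subst (asm) sums_Suc_iff) simp
qed

text \<open>Pulling out one factor \<open>1 / (1 - r)\<close> leaves an exponential series. The type
  is general because the sum is needed both over the complex numbers and for the real series of
  norms.\<close>

lemma exp_series_geometric_sums:
  fixes y r :: "'a :: {real_normed_field, banach}"
  shows "(\<lambda>k. y ^ k / fact k * (r ^ k / (1 - r) ^ Suc k)) sums (exp (r * y / (1 - r)) / (1 - r))"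
proof -
  have "(\<lambda>k. (r * y / (1 - r)) ^ k /\<^sub>R fact k / (1 - r)) sums (exp (r * y / (1 - r)) / (1 - r))"
    by (intro sums_divide exp_converges)
  then show ?thesis
    by (simp add: scaleR_conv_of_real field_simps)
qed

text \<open>Expanding \<open>laguerre\<close> turns the series into a double sum over
  \<open>k\<close> and \<open>m\<close>. Absolute convergence allows summing over \<open>m\<close>
  first, by the negative binomial series, and then over \<open>k\<close>, by the exponential
  series.\<close>

lemma laguerre_sums:
  assumes "cmod r < 1"
  shows "(\<lambda>m. r ^ m * laguerre m x) sums (exp (- (r / (1 - r)) * x) / (1 - r))"
proof -
  define f where "f k m = (- x) ^ k / fact k * (of_nat (m choose k) * r ^ m)" for k m
  have row: "(f k has_sum ((- x) ^ k / fact k * (r ^ k / (1 - r) ^ Suc k))) UNIV"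
    and rown: "((\<lambda>m. norm (f k m)) has_sum
      (cmod x ^ k / fact k * (cmod r ^ k / (1 - cmod r) ^ Suc k))) UNIV" for k
  proof -
    have "(\<lambda>m. norm (f k m)) sums (cmod x ^ k / fact k * (cmod r ^ k / (1 - cmod r) ^ Suc k))"
      using sums_mult[OF choose_power_sums[of "cmod r" k], of "cmod x ^ k / fact k"] assms
      by (simp add: f_def norm_mult norm_divide norm_power)
    then show "((\<lambda>m. norm (f k m)) has_sum
      (cmod x ^ k / fact k * (cmod r ^ k / (1 - cmod r) ^ Suc k))) UNIV"
      by (simp add: sums_nonneg_imp_has_sum)
    from \<open>(\<lambda>m. norm (f k m)) sums _\<close> have "summable (\<lambda>m. norm (f k m))"
      by (rule sums_summable)
    moreover have "f k sums ((- x) ^ k / fact k * (r ^ k / (1 - r) ^ Suc k))"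
      unfolding f_def by (intro sums_mult choose_power_sums assms)
    ultimately show "(f k has_sum ((- x) ^ k / fact k * (r ^ k / (1 - r) ^ Suc k))) UNIV"
      by (rule norm_summable_imp_has_sum)
  qed
  \<comment> \<open>The norms have row sums of the same closed form, with \<open>cmod x\<close> and
    \<open>cmod r\<close> as parameters, and these row sums form a convergent real exponential
    series.\<close>
  have "(\<lambda>p. norm (case p of (k, m) \<Rightarrow> f k m)) summable_on (UNIV \<times> UNIV)"
  proof (subst Infinite_Sum.abs_summable_on_Sigma_iff, intro conjI ballI)
    show "(\<lambda>m. norm (case (k, m) of (k, m) \<Rightarrow> f k m)) summable_on UNIV" for k
      using rown[of k] by (auto intro: has_sum_imp_summable)
    have "(\<lambda>k. cmod x ^ k / fact k * (cmod r ^ k / (1 - cmod r) ^ Suc k)) summable_on UNIV"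
      by (rule summable_nonneg_imp_summable_on[OF sums_summable[OF exp_series_geometric_sums]])
         (use assms in auto)
    then show "(\<lambda>k. norm (\<Sum>\<^sub>\<infinity>m\<in>UNIV. norm (case (k, m) of (k, m) \<Rightarrow> f k m))) summable_on UNIV"
      using assms by (simp add: infsumI[OF rown] norm_mult norm_divide norm_power)
  qed
  then have sf: "(\<lambda>(k, m). f k m) summable_on (UNIV \<times> UNIV)"
    by (rule abs_summable_summable)
  have "((\<lambda>k. (- x) ^ k / fact k * (r ^ k / (1 - r) ^ Suc k)) has_sum
      (\<Sum>\<^sub>\<infinity>(k, m)\<in>UNIV \<times> UNIV. f k m)) UNIV"
    by (rule has_sum_SigmaD[OF has_sum_infsum[OF sf]]) (use row in auto)
  then have total: "(\<Sum>\<^sub>\<infinity>(k, m)\<in>UNIV \<times> UNIV. f k m) = exp (- (r / (1 - r)) * x) / (1 - r)"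
    using sums_unique2[OF has_sum_imp_sums exp_series_geometric_sums] by fastforce
  have "((\<lambda>(m, k). f k m) has_sum exp (- (r / (1 - r)) * x) / (1 - r)) (UNIV \<times> UNIV)"
    using has_sum_infsum[OF sf] unfolding total
    by (subst (asm) has_sum_swap) simp
  moreover have "((\<lambda>k. f k m) has_sum (r ^ m * laguerre m x)) UNIV" for m
  proof -
    \<comment> \<open>For fixed \<open>m\<close> only \<open>k \<le> m\<close> contributes, since
      the binomial coefficient vanishes beyond.\<close>
    have "((\<lambda>k. f k m) has_sum (\<Sum>k\<le>m. f k m)) {..m}"
      by (rule has_sum_finite) simp
    also have "?this \<longleftrightarrow> ((\<lambda>k. f k m) has_sum (\<Sum>k\<le>m. f k m)) UNIV"
      by (rule has_sum_cong_neutral) (auto simp: f_def)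
    finally show ?thesis
      by (simp add: f_def laguerre_def sum_distrib_left mult_ac)
  qed
  ultimately have "((\<lambda>m. r ^ m * laguerre m x) has_sum exp (- (r / (1 - r)) * x) / (1 - r)) UNIV"
    using has_sum_SigmaD[where f = "\<lambda>(m, k). f k m" and A = UNIV and B = "\<lambda>_. UNIV"
        and g = "\<lambda>m. r ^ m * laguerre m x"]
    by (simp only: prod.case)
  then show ?thesis
    by (rule has_sum_imp_sums)
qed

section \<open>The generating function\<close>

lemma ito_hermite2_sums:
  assumes "cmod t = 1"
  shows "(\<lambda>n. u ^ m * t ^ n / (fact m * fact n) * ito_hermite2 m n n m z w) sums
    (exp (t * ((cnj z)\<^sup>2 + (cnj w)\<^sup>2)) *
     ((u * t) ^ m * laguerre m (of_real ((cmod (z - t * cnj z + \<i> * (w - t * cnj w)))\<^sup>2))))"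
proof -
  define a b where "a = z + \<i> * w" and "b = cnj z + \<i> * cnj w"
  define x where "x = (of_real ((cmod (a - t * b))\<^sup>2) :: complex)"
  have "t * cnj t = 1"
    using assms complex_norm_square[of t] by simp
  \<comment> \<open>Here \<open>|t| = 1\<close> enters: \<open>cnj b\<close> is replaced by
    \<open>t * cnj t * cnj b\<close>, which exposes the conjugate of
    \<open>a - t * b\<close>.\<close>
  then have "(a - t * b) * (cnj b - t * cnj a) = - t * (a - t * b) * (cnj a - cnj t * cnj b)"
    by algebra
  then have "(a - t * b) * (cnj b - t * cnj a) = - t * x"
    unfolding x_def complex_norm_square by (simp add: mult.assoc)
  note L = shifted_deriv_poly_diagonal[OF this]
  \<comment> \<open>This is the factorization of a sum of two squares, with
    \<open>cnj a = cnj z - \<i> * cnj w\<close>.\<close>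
  have ab: "t * cnj a * b = t * ((cnj z)\<^sup>2 + (cnj w)\<^sup>2)"
    by (simp add: a_def b_def power2_eq_square algebra_simps)
  have x: "x = of_real ((cmod (z - t * cnj z + \<i> * (w - t * cnj w)))\<^sup>2)"
    by (simp add: x_def a_def b_def algebra_simps)
  show ?thesis
    using sums_mult[OF ito_poly_mult_sums[of t m a "cnj a" m b "cnj b"], of "u ^ m / fact m"]
    unfolding L ab x ito_hermite2_def ito_hermite_eq
    by (simp add: a_def[symmetric] b_def[symmetric] power_mult_distrib mult_ac)
qed

lemma ito_hermite2_generating_function:
  assumes "cmod u < 1" "cmod t = 1"
  shows "(\<lambda>m. \<Sum>n. u ^ m * t ^ n / (fact m * fact n) * ito_hermite2 m n n m z w) sums
          (exp (t * ((cnj z)\<^sup>2 + (cnj w)\<^sup>2)) / (1 - u * t) *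
           exp (- (u * t / (1 - u * t)) *
                of_real ((cmod (z - t * cnj z + \<i> * (w - t * cnj w)))\<^sup>2)))"
proof -
  have "cmod (u * t) < 1"
    using assms by (simp add: norm_mult)
  from sums_mult[OF laguerre_sums[OF this]] show ?thesis
    unfolding sums_unique[OF ito_hermite2_sums[OF assms(2)], symmetric]
    by (simp only: times_divide_eq_left times_divide_eq_right)
qed

theorem proposition3p26:
  fixes z w :: complex
  shows
    "(\<forall>u t :: complex. cmod u < 1 \<longrightarrow> cmod t = 1 \<longrightarrow>
        (\<forall>m. summable (\<lambda>n. u ^ m * t ^ n / (fact m * fact n) * ito_hermite2 m n n m z w)) \<and>
        (\<lambda>m. \<Sum>n. u ^ m * t ^ n / (fact m * fact n) * ito_hermite2 m n n m z w) sums
          (exp (t * ((cnj z)\<^sup>2 + (cnj w)\<^sup>2)) / (1 - u * t) *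
           exp (- (u * t / (1 - u * t)) *
                of_real ((cmod (z - t * cnj z + \<i> * (w - t * cnj w)))\<^sup>2)))) \<and>
     (\<forall>u :: complex. cmod u < 1 \<longrightarrow>
        (\<forall>m. summable (\<lambda>n. u ^ m / (fact m * fact n) * ito_hermite2 m n n m z w)) \<and>
        (\<lambda>m. \<Sum>n. u ^ m / (fact m * fact n) * ito_hermite2 m n n m z w) sums
          (exp ((cnj z)\<^sup>2 + (cnj w)\<^sup>2) / (1 - u) *
           exp (- (4 * u / (1 - u)) * of_real ((Im z)\<^sup>2 + (Im w)\<^sup>2))))"
proof (intro conjI allI impI)
  fix u t :: complex and m
  assume ut: "cmod u < 1" "cmod t = 1"
  show "summable (\<lambda>n. u ^ m * t ^ n / (fact m * fact n) * ito_hermite2 m n n m z w)"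
    by (rule sums_summable[OF ito_hermite2_sums[OF ut(2)]])
  show "(\<lambda>m. \<Sum>n. u ^ m * t ^ n / (fact m * fact n) * ito_hermite2 m n n m z w) sums
          (exp (t * ((cnj z)\<^sup>2 + (cnj w)\<^sup>2)) / (1 - u * t) *
           exp (- (u * t / (1 - u * t)) *
                of_real ((cmod (z - t * cnj z + \<i> * (w - t * cnj w)))\<^sup>2)))"
    by (rule ito_hermite2_generating_function[OF ut])
next
  fix u :: complex and m
  assume u: "cmod u < 1"
  show "summable (\<lambda>n. u ^ m / (fact m * fact n) * ito_hermite2 m n n m z w)"
    using sums_summable[OF ito_hermite2_sums[of 1 u m z w]] by simp
  \<comment> \<open>At \<open>t = 1\<close> the number inside is
    \<open>2 * \<i> * Im z - 2 * Im w\<close>, whence the factor 4.\<close>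
  have "(cmod (z - cnj z + \<i> * (w - cnj w)))\<^sup>2 = 4 * ((Im z)\<^sup>2 + (Im w)\<^sup>2)"
    by (simp only: cmod_power2) (simp add: power2_eq_square algebra_simps)
  then show "(\<lambda>m. \<Sum>n. u ^ m / (fact m * fact n) * ito_hermite2 m n n m z w) sums
          (exp ((cnj z)\<^sup>2 + (cnj w)\<^sup>2) / (1 - u) *
           exp (- (4 * u / (1 - u)) * of_real ((Im z)\<^sup>2 + (Im w)\<^sup>2)))"
    using ito_hermite2_generating_function[OF u, of 1 z w] by (simp add: mult_ac)
qed

end
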